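(* Let $G=(V,E)$ be a connected graph (not necessarily finite) of bounded degree such that $\deg(x)\le\Delta$ for all $x\in V$, and let $o\in V$ be a fixed vertex. Then for Bernoulli percolation on the layered graph $G^\times$ we have $$\forall n\ge 0\ \ \forall p\in\Big[0,\frac{1}{\Delta+1.4}\Big]:\quad \mathbb{E}_p(\mathcal{W}_n)\ge\mathbb{E}_p(\mathcal{W}_{n+1}).$$
   Context: Graphs are simple. The layered graph $G^\times$ is the Cartesian product of $G=(V,E)$ and $\mathbb{Z}$: its vertex set is $V\times\mathbb{Z}$; its edges are the horizontal edges $(u,l)(v,l)$ with $uv\in E$, $l\in\mathbb{Z}$, and the vertical edges $(u,l-1)(u,l)$ with $u\in V$, $l\in\mathbb{Z}$. Bernoulli (bond) percolation with parameter $p$: independent random variables $\mathcal{Z}_e$, $e\in E(G^\times)$, with $\mathbb{P}_p(\mathcal{Z}_e=1)=p$ (open) and $\mathbb{P}_p(\mathcal{Z}_e=0)=1-p$ (closed); $\mathbb{E}_p$ is the corresponding expectation. $u'\leftrightarrow v'$ means that there is a path of open edges from $u'$ to $v'$. For $n\ge 0$, $\mathcal{W}_n=|\{v\in V:(v,n)\leftrightarrow(o,0)\}|$ is the number of vertices in layer $V\times\{n\}$ connected to $(o,0)$. *)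

theory Defs
  imports "HOL-Probability.Probability"
begin

text \<open>
  A graph is given by a vertex set and a set of two-element edges. The edge set of a possibly
  infinite graph may be infinite; isolated vertices are allowed.
\<close>

definition simple_graph :: "'a set \<Rightarrow> 'a set set \<Rightarrow> bool" where
  "simple_graph V E \<longleftrightarrow> (\<forall>e\<in>E. e \<subseteq> V \<and> card e = 2)"

definition nbhd :: "'a set set \<Rightarrow> 'a \<Rightarrow> 'a set" where
  "nbhd E x = {y. {x, y} \<in> E}"

text \<open>Finiteness is required explicitly, since \<^const>\<open>card\<close> is \<open>0\<close> on infinite sets.\<close>

definition degrees_bounded_by :: "'a set \<Rightarrow> 'a set set \<Rightarrow> real \<Rightarrow> bool" where
  "degrees_bounded_by V E \<Delta> \<longleftrightarrow> (\<forall>x\<in>V. finite (nbhd E x) \<and> real (card (nbhd E x)) \<le> \<Delta>)"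

definition graph_path :: "'a set \<Rightarrow> 'a set set \<Rightarrow> 'a list \<Rightarrow> bool" where
  "graph_path V E xs \<longleftrightarrow>
     xs \<noteq> [] \<and> set xs \<subseteq> V \<and> distinct xs \<and> successively (\<lambda>x y. {x, y} \<in> E) xs"

text \<open>The one-vertex path joins every vertex to itself.\<close>

definition joined :: "'a set \<Rightarrow> 'a set set \<Rightarrow> 'a \<Rightarrow> 'a \<Rightarrow> bool" where
  "joined V E u v \<longleftrightarrow> (\<exists>xs. graph_path V E xs \<and> hd xs = u \<and> last xs = v)"

definition connected_graph :: "'a set \<Rightarrow> 'a set set \<Rightarrow> bool" where
  "connected_graph V E \<longleftrightarrow> V \<noteq> {} \<and> (\<forall>u\<in>V. \<forall>v\<in>V. joined V E u v)"

definition layered_verts :: "'a set \<Rightarrow> ('a \<times> int) set" where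
  "layered_verts V = V \<times> UNIV"

definition layered_edges :: "'a set \<Rightarrow> 'a set set \<Rightarrow> ('a \<times> int) set set" where
  "layered_edges V E =
     {{(u, l), (v, l)} | u v l. {u, v} \<in> E} \<union> {{(u, l - 1), (u, l)} | u l. u \<in> V}"

text \<open>
  The product space of all configurations \<open>\<omega>\<close>: the variable attached to an edge \<open>e\<close> of the
  layered graph is the coordinate \<open>\<omega> e\<close>, with \<^const>\<open>True\<close> for open and \<^const>\<open>False\<close> for closed.
  The parameter has to lie in \<open>{0..1}\<close>.
\<close>

definition percolation :: "'a set \<Rightarrow> 'a set set \<Rightarrow> real \<Rightarrow> (('a \<times> int) set \<Rightarrow> bool) measure" where
  "percolation V E p = Pi\<^sub>M (layered_edges V E) (\<lambda>_. measure_pmf (bernoulli_pmf p))"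

definition open_edges :: "'a set \<Rightarrow> 'a set set \<Rightarrow> (('a \<times> int) set \<Rightarrow> bool) \<Rightarrow> ('a \<times> int) set set" where
  "open_edges V E \<omega> = {e \<in> layered_edges V E. \<omega> e}"

definition open_joined ::
    "'a set \<Rightarrow> 'a set set \<Rightarrow> (('a \<times> int) set \<Rightarrow> bool) \<Rightarrow> 'a \<times> int \<Rightarrow> 'a \<times> int \<Rightarrow> bool" where
  "open_joined V E \<omega> = joined (layered_verts V) (open_edges V E \<omega>)"

text \<open>
  The number of vertices is taken in \<open>[0, \<infinity>]\<close>, and so is its expectation: counting measure gives
  \<open>\<infinity>\<close> on infinite sets.
\<close>

definition layer_count ::
    "'a set \<Rightarrow> 'a set set \<Rightarrow> 'a \<Rightarrow> nat \<Rightarrow> (('a \<times> int) set \<Rightarrow> bool) \<Rightarrow> ennreal" where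
  "layer_count V E r n \<omega> =
     emeasure (count_space UNIV) {v \<in> V. open_joined V E \<omega> (v, int n) (r, 0)}"

definition expected_layer_count :: "'a set \<Rightarrow> 'a set set \<Rightarrow> 'a \<Rightarrow> real \<Rightarrow> nat \<Rightarrow> ennreal" where
  "expected_layer_count V E r p n = (\<integral>\<^sup>+ \<omega>. layer_count V E r n \<omega> \<partial>percolation V E p)"

end

theory Submission imports Defs begin

text \<open>
  Follow an open path from \<open>(v, n + 1)\<close> to \<open>(r, 0)\<close> until it first visits layer \<open>n\<close>, at \<open>(u, n)\<close>
  say. Up to there the path is a self-avoiding walk in the layers above \<open>n\<close> that joins
  \<open>(v, n + 1)\<close> to \<open>(u, n + 1)\<close>, plus one vertical edge; the rest of the path joins \<open>(u, n)\<close> to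
  \<open>(r, 0)\<close> and avoids these edges. By independence, a given initial piece with \<open>k + 1\<close> edges
  contributes at most \<open>p\<^sup>k\<^sup>+\<^sup>1\<close> times the probability of \<open>(u, n) \<leftrightarrow> (r, 0)\<close>. So it suffices that, for
  each \<open>u\<close>, the sum of \<open>p\<^sup>k\<^sup>+\<^sup>1\<close> over all initial pieces is at most \<open>1\<close>. This holds already for
  non-backtracking walks in place of self-avoiding ones: their generating function is dominated
  by a function of the last step that is superharmonic when \<open>p * \<Delta> \<le> 1 - 1.4 * p\<close>.
\<close>

section \<open>Edge sets of paths\<close>

fun path_edges :: "'b list \<Rightarrow> 'b set set" where
  "path_edges (x # y # xs) = insert {x, y} (path_edges (y # xs))"
| "path_edges _ = {}"

lemma finite_path_edges [simp]: "finite (path_edges xs)"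
  by (induction xs rule: path_edges.induct) auto

lemma path_edges_subset_iff:
  "path_edges xs \<subseteq> S \<longleftrightarrow> successively (\<lambda>x y. {x, y} \<in> S) xs"
  by (induction xs rule: path_edges.induct) auto

lemma Union_path_edges_subset: "\<Union>(path_edges xs) \<subseteq> set xs"
  by (induction xs rule: path_edges.induct) auto

lemma card_path_edges: "distinct xs \<Longrightarrow> card (path_edges xs) = length xs - 1"
proof (induction xs rule: path_edges.induct)
  case (1 x y xs)
  have "{x, y} \<notin> path_edges (y # xs)"
    using 1(2) Union_path_edges_subset[of "y # xs"] by auto
  then show ?case
    using 1 by simp
qed auto

text \<open>Every edge of \<open>z # rev ys\<close> has an endpoint in \<open>ys\<close>, and no
  edge of \<open>z # zs\<close> does. This provides the disjoint edge sets needed for independence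
  when an open path is cut at \<open>z\<close>.\<close>

lemma path_edges_append_disjoint:
  assumes "distinct (ys @ z # zs)"
  shows "path_edges (z # zs) \<inter> path_edges (z # rev ys) = {}"
proof -
  have "e \<inter> set ys \<noteq> {}" if "e \<in> path_edges (z # rev ys)" "distinct (z # rev ys)" for e
  proof (cases "rev ys")
    case (Cons y us)
    \<comment> \<open>The first edge \<open>{z, y}\<close> meets \<open>ys\<close> in
      \<open>y\<close>; every later edge is nonempty and lies inside \<open>ys\<close>.\<close>
    then have "z \<notin> \<Union>(path_edges (rev ys))"
      using that(2) Union_path_edges_subset[of "rev ys"] by auto
    moreover have "\<Union>(path_edges (rev ys)) \<subseteq> set ys"
      using Union_path_edges_subset[of "rev ys"] by auto
    moreover have "y \<in> set ys"
      using Cons by (metis list.set_intros(1) set_rev)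
    moreover have "f \<noteq> {}" if "f \<in> path_edges xs" for f and xs :: "'a list"
      using that by (induction xs rule: path_edges.induct) auto
    ultimately show ?thesis
      using that(1) Cons by fastforce
  qed (use that in simp)
  moreover have "e \<inter> set ys = {}" if "e \<in> path_edges (z # zs)" for e
    using that assms Union_path_edges_subset[of "z # zs"] by auto
  moreover have "distinct (z # rev ys)"
    using assms by auto
  ultimately show ?thesis
    by blast
qed

lemma graph_path_iff:
  "graph_path V E xs \<longleftrightarrow> xs \<noteq> [] \<and> set xs \<subseteq> V \<and> distinct xs \<and> path_edges xs \<subseteq> E"
  by (simp add: graph_path_def path_edges_subset_iff)

lemma joined_mono: "joined V E u v \<Longrightarrow> E \<subseteq> F \<Longrightarrow> joined V F u v"
  unfolding joined_def graph_path_iff by blast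

section \<open>Independence of coordinates in product measures\<close>

lemma PiM_indep_vars_coordinates:
  assumes "product_prob_space M" "I \<noteq> {}"
  shows "prob_space.indep_vars (PiM I M) M (\<lambda>i \<omega>. \<omega> i) I"
proof -
  interpret product_prob_space M I by fact
  show ?thesis
  proof (subst P.indep_vars_iff_distr_eq_PiM')
    \<comment> \<open>Points of the product space are extensional, so restricting them to
      \<open>I\<close> changes nothing: the joint law of the coordinates is the product measure
      itself.\<close>
    have "distr (PiM I M) (PiM I M) (\<lambda>x. \<lambda>i\<in>I. x i) = distr (PiM I M) (PiM I M) (\<lambda>x. x)"
      by (intro distr_cong) (auto simp: space_PiM intro: PiE_restrict)
    also have "\<dots> = PiM I M"
      by (rule distr_id)
    also have "\<dots> = PiM I (\<lambda>i. distr (PiM I M) (M i) (\<lambda>\<omega>. \<omega> i))"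
      by (intro PiM_cong refl PiM_component[symmetric])
    finally show "distr (PiM I M) (PiM I M) (\<lambda>x. \<lambda>i\<in>I. x i) =
      PiM I (\<lambda>i. distr (PiM I M) (M i) (\<lambda>\<omega>. \<omega> i))" .
  qed (use assms in auto)
qed

text \<open>The coordinates in \<open>K\<close> and those in \<open>L - K\<close> form independent
  families, and "all of \<open>K\<close> open" is a finite cylinder of probability
  \<open>p ^ card K\<close>.\<close>

lemma PiM_bernoulli_open_indep:
  fixes p :: real and L K :: "'e set"
  defines "M \<equiv> (\<lambda>_ :: 'e. measure_pmf (bernoulli_pmf p))"
  assumes p: "0 \<le> p" "p \<le> 1" and K: "finite K" "K \<subseteq> L" and L: "L \<noteq> {}"
    and B: "B \<in> sets (PiM (L - K) M)"
  shows "emeasure (PiM L M) {\<omega> \<in> space (PiM L M). (\<forall>e\<in>K. \<omega> e) \<and> restrict \<omega> (L - K) \<in> B} =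
    ennreal (p ^ card K) * emeasure (PiM L M) {\<omega> \<in> space (PiM L M). restrict \<omega> (L - K) \<in> B}"
proof -
  have M: "product_prob_space M"
    by (intro product_prob_spaceI) (simp add: M_def prob_space_measure_pmf)
  interpret product_prob_space M L by fact
  have "P.indep_var (PiM K M) (\<lambda>\<omega>. restrict (\<lambda>i. \<omega> i) K) (PiM (L - K) M) (\<lambda>\<omega>. restrict (\<lambda>i. \<omega> i) (L - K))"
    by (intro P.indep_var_restrict[OF PiM_indep_vars_coordinates[OF M L]]) (use K in auto)
  note P.indep_varD[OF this, of "PiE K (\<lambda>_. {True})" B]
  moreover have "PiE K (\<lambda>_. {True}) \<in> sets (PiM K M)"
    using K by (intro sets_PiM_I_finite) (auto simp: M_def)
  moreover have "(\<lambda>x. (restrict x K, restrict x (L - K))) -` ((PiE K (\<lambda>_. {True})) \<times> B) \<inter> space (PiM L M) =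
     {\<omega> \<in> space (PiM L M). (\<forall>e\<in>K. \<omega> e) \<and> restrict \<omega> (L - K) \<in> B}"
  proof -
    have "restrict x K = (\<lambda>e\<in>K. True) \<longleftrightarrow> (\<forall>e\<in>K. x e)" for x :: "'e \<Rightarrow> bool"
      by (auto simp: fun_eq_iff restrict_def)
    then show ?thesis
      by auto
  qed
  moreover have "(\<lambda>x. restrict x (L - K)) -` B \<inter> space (PiM L M) =
     {\<omega> \<in> space (PiM L M). restrict \<omega> (L - K) \<in> B}"
    by auto
  moreover have "P.prob ((\<lambda>x. restrict x K) -` (PiE K (\<lambda>_. {True})) \<inter> space (PiM L M)) = p ^ card K"
  proof -
    have "(\<lambda>x. restrict x K) -` (PiE K (\<lambda>_. {True})) \<inter> space (PiM L M) = prod_emb L M K (PiE K (\<lambda>_. {True}))"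
      by (auto simp: prod_emb_def space_PiM)
    also have "P.prob \<dots> = (\<Prod>e\<in>K. measure (M e) {True})"
      using K by (intro measure_PiM_emb) (auto simp: M_def)
    also have "\<dots> = p ^ card K"
      using p by (simp add: M_def measure_pmf_single)
    finally show ?thesis .
  qed
  ultimately show ?thesis
    using B p by (simp add: P.emeasure_eq_measure ennreal_mult)
qed

lemma emeasure_count_space_image_le:
  "emeasure (count_space UNIV) (f ` A) \<le> emeasure (count_space UNIV) A"
  by (cases "finite A") (auto intro: card_image_le)

section \<open>Non-backtracking walks above a layer and their generating function\<close>

text \<open>
  \<open>upper_walk L m a b cs\<close>: after a step from \<open>a\<close> to \<open>b\<close>, the walk continues along \<open>cs\<close> inside the
  layers \<open>\<ge> m\<close> and ends in layer \<open>m\<close>. Only immediate reversals are excluded, which keeps the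
  definition recursive.
\<close>

fun upper_walk :: "('a \<times> int) set set \<Rightarrow> int \<Rightarrow> 'a \<times> int \<Rightarrow> 'a \<times> int \<Rightarrow> ('a \<times> int) list \<Rightarrow> bool" where
  "upper_walk L m a b [] \<longleftrightarrow> snd b = m"
| "upper_walk L m a b (c # cs) \<longleftrightarrow> {b, c} \<in> L \<and> c \<noteq> a \<and> m \<le> snd c \<and> upper_walk L m b c cs"

text \<open>Distinct vertices rule out immediate reversals, so self-avoiding walks are among the
  walks counted here.\<close>

lemma upper_walkI:
  assumes "path_edges (a # b # cs) \<subseteq> L" "distinct (a # b # cs)"
    and "\<forall>c\<in>set cs. m \<le> snd c" "snd (last (b # cs)) = m"
  shows "upper_walk L m a b cs"
  using assms by (induction cs arbitrary: a b) auto

lemma path_edges_upper_walk: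
  "upper_walk L m a b cs \<Longrightarrow> {a, b} \<in> L \<Longrightarrow> path_edges (a # b # cs) \<subseteq> L"
proof (induction cs arbitrary: a b)
  case (Cons c cs)
  then show ?case
    using Cons.IH[of b c] by simp
qed simp

text \<open>Truncation by length makes the generating function a finite sum. The strict bound leaves
  no walk at all for \<open>k = 0\<close>, where the induction starts.\<close>

definition upper_walks ::
    "('a \<times> int) set set \<Rightarrow> int \<Rightarrow> nat \<Rightarrow> 'a \<times> int \<Rightarrow> 'a \<times> int \<Rightarrow> ('a \<times> int) list set" where
  "upper_walks L m k a b = {cs. upper_walk L m a b cs \<and> length cs < k}"

definition upper_steps :: "('a \<times> int) set set \<Rightarrow> int \<Rightarrow> 'a \<times> int \<Rightarrow> 'a \<times> int \<Rightarrow> ('a \<times> int) set" where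
  "upper_steps L m a b = {c. {b, c} \<in> L \<and> c \<noteq> a \<and> m \<le> snd c}"

lemma upper_walks_0 [simp]: "upper_walks L m 0 a b = {}"
  by (simp add: upper_walks_def)

lemma upper_walks_Suc:
  "upper_walks L m (Suc k) a b = (if snd b = m then {[]} else {}) \<union>
     (\<lambda>(c, cs). c # cs) ` (SIGMA c : upper_steps L m a b. upper_walks L m k b c)"
proof (intro set_eqI)
  fix cs
  show "cs \<in> upper_walks L m (Suc k) a b \<longleftrightarrow> cs \<in> (if snd b = m then {[]} else {}) \<union>
     (\<lambda>(c, cs). c # cs) ` (SIGMA c : upper_steps L m a b. upper_walks L m k b c)"
    by (cases cs) (auto simp: upper_walks_def upper_steps_def image_iff)
qed

text \<open>First-step decomposition: a walk is either empty or determined uniquely by its first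
  vertex \<open>c\<close> and a shorter walk after the step from \<open>b\<close> to
  \<open>c\<close>.\<close>

lemma sum_upper_walks_Suc:
  fixes p :: real
  assumes "finite (upper_steps L m a b)"
    and "\<And>c. c \<in> upper_steps L m a b \<Longrightarrow> finite (upper_walks L m k b c)"
  shows "(\<Sum>cs\<in>upper_walks L m (Suc k) a b. p ^ length cs) =
    of_bool (snd b = m) + (\<Sum>c\<in>upper_steps L m a b. p * (\<Sum>cs\<in>upper_walks L m k b c. p ^ length cs))"
proof -
  let ?S = "SIGMA c : upper_steps L m a b. upper_walks L m k b c"
  have fin: "finite ((\<lambda>(c, cs). c # cs) ` ?S)"
    using assms by auto
  have "(\<Sum>cs\<in>upper_walks L m (Suc k) a b. p ^ length cs) =
     (\<Sum>cs :: ('a \<times> int) list\<in>(if snd b = m then {[]} else {}). p ^ length cs) + (\<Sum>cs\<in>(\<lambda>(c, cs). c # cs) ` ?S. p ^ length cs)"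
    unfolding upper_walks_Suc using fin by (intro sum.union_disjoint) auto
  also have "(\<Sum>cs\<in>(\<lambda>(c, cs). c # cs) ` ?S. p ^ length cs) = (\<Sum>(c, cs)\<in>?S. p * p ^ length cs)"
    by (subst sum.reindex) (auto simp: inj_on_def intro!: sum.cong)
  also have "\<dots> = (\<Sum>c\<in>upper_steps L m a b. \<Sum>cs\<in>upper_walks L m k b c. p * p ^ length cs)"
    using assms by (subst sum.Sigma) auto
  finally show ?thesis
    by (simp add: sum_distrib_left)
qed

lemma layered_edges_iff:
  "{(w, l), c} \<in> layered_edges V E \<longleftrightarrow>
     snd c = l \<and> {w, fst c} \<in> E \<or> fst c = w \<and> w \<in> V \<and> (snd c = l + 1 \<or> snd c = l - 1)"
proof (cases c)
  case [simp]: (Pair w' l')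
  have "{(w, l), (w', l')} \<in> {{(u, l), (v, l)} | u v l. {u, v} \<in> E} \<longleftrightarrow> l' = l \<and> {w, w'} \<in> E"
    by (auto simp: doubleton_eq_iff insert_commute)
  moreover have "{(w, l), (w', l')} \<in> {{(u, l - 1), (u, l)} | u l. u \<in> V} \<longleftrightarrow>
      w' = w \<and> w \<in> V \<and> (l' = l + 1 \<or> l' = l - 1)"
    by (auto simp: doubleton_eq_iff) (metis add_diff_cancel_right')+
  ultimately show ?thesis
    by (simp add: layered_edges_def)
qed

text \<open>
  Bounds \<open>p\<close> times the generating function of the walks that start with the step from \<open>a\<close> to \<open>b\<close>.
  Given the values \<open>1\<close> (down) and \<open>Y = 1 - p\<close> (up), the value \<open>X\<close> for horizontal steps solves
  \<open>X = p + (1 - 2.4 * p) * X + p * Y\<close>. The initial step enters layer \<open>m\<close> from below and gets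
  weight \<open>p + Y = 1\<close>.
\<close>

definition step_weight :: "real \<Rightarrow> int \<Rightarrow> 'a \<times> int \<Rightarrow> 'a \<times> int \<Rightarrow> real" where
  "step_weight p m a b =
     (if snd a = snd b then 5 * (2 - p) / 12
      else if snd a < snd b \<and> m < snd b then 1 - p else 1)"

section \<open>Superharmonicity of the step weight\<close>

locale layered_percolation =
  fixes V :: "'a set" and E :: "'a set set" and \<Delta> :: real and r :: 'a and p :: real
  assumes simple: "simple_graph V E"
    and conn: "connected_graph V E"
    and deg: "degrees_bounded_by V E \<Delta>"
    and root: "r \<in> V"
    and p_range: "p \<in> {0..1 / (\<Delta> + 1.4)}"
begin

abbreviation "L \<equiv> layered_edges V E"

text \<open>No membership \<open>x \<in> V\<close> is required: outside \<open>V\<close> there are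
  no neighbours, and the degree of \<open>r\<close> shows \<open>0 \<le> \<Delta>\<close>.\<close>

lemma nbhd_bounded: "finite (nbhd E x)" "real (card (nbhd E x)) \<le> \<Delta>"
proof -
  have D: "0 \<le> \<Delta>"
    using deg root of_nat_0_le_iff order_trans unfolding degrees_bounded_by_def by blast
  have "nbhd E x = {}" if "x \<notin> V"
    using that simple by (auto simp: nbhd_def simple_graph_def)
  then show "finite (nbhd E x)" "real (card (nbhd E x)) \<le> \<Delta>"
    using deg D by (cases "x \<in> V"; simp add: degrees_bounded_by_def)+
qed

lemma p_bounds: "0 \<le> p" "p * \<Delta> \<le> 1 - 1.4 * p" "p \<le> 1"
proof -
  have D: "0 \<le> \<Delta>"
    using nbhd_bounded(2)[of r] by linarith
  show "0 \<le> p"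
    using p_range by simp
  have "p \<le> 1 / (\<Delta> + 1.4)"
    using p_range by simp
  then have *: "p * (\<Delta> + 1.4) \<le> 1"
    using D by (simp add: pos_le_divide_eq)
  then show "p * \<Delta> \<le> 1 - 1.4 * p"
    by (simp add: algebra_simps)
  have "0 \<le> p * \<Delta>"
    using \<open>0 \<le> p\<close> D by simp
  with * \<open>0 \<le> p\<close> show "p \<le> 1"
    unfolding distrib_left by linarith
qed

lemma upper_walk_verts:
  assumes "upper_walk L m a b cs"
  shows "set cs \<subseteq> layered_verts V"
  using assms
proof (induction cs arbitrary: a b)
  case (Cons c cs)
  then have "fst c \<in> V"
    using simple by (cases b) (auto simp: layered_edges_iff simple_graph_def)
  then show ?case
    using Cons.IH[of b c] Cons.prems by (simp add: layered_verts_def mem_Times_iff)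
qed simp

lemma finite_upper_steps: "finite (upper_steps L m a b)"
proof (rule finite_subset)
  show "upper_steps L m a b \<subseteq>
    (\<lambda>w. (w, snd b)) ` nbhd E (fst b) \<union> {(fst b, snd b + 1), (fst b, snd b - 1)}"
    by (cases b) (auto simp: upper_steps_def layered_edges_iff nbhd_def image_iff)
qed (use nbhd_bounded in auto)

lemma step_weight_nonneg: "0 \<le> step_weight p m a b"
  using p_bounds by (simp add: step_weight_def)

text \<open>The next vertices are split into horizontal (\<open>H\<close>), upper (\<open>U\<close>)
  and lower (\<open>D\<close>) ones, with weights \<open>X\<close>, \<open>1 - p\<close> and
  \<open>1\<close>, the predecessor \<open>a\<close> being removed. In layer \<open>m\<close> the
  step down is forbidden, and the term \<open>p\<close> for ending the walk takes its place. The
  three cases are the directions of the step from \<open>a\<close> to \<open>b\<close>.\<close>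

lemma step_weight_superharmonic:
  assumes ab: "{a, b} \<in> L" and b: "m \<le> snd b"
  shows "(\<Sum>c\<in>upper_steps L m a b. p * step_weight p m b c) + p * of_bool (snd b = m) \<le> step_weight p m a b"
proof -
  obtain w l where [simp]: "b = (w, l)"
    by (cases b)
  define X where "X = 5 * (2 - p) / 12"
  define S where "S = (\<Sum>c\<in>upper_steps L m a b. p * step_weight p m b c)"
  define H where "H = (\<lambda>w. (w, l)) ` nbhd E w - {a}"
  define U where "U = {(w, l + 1)} - {a}"
  define D where "D = (if m \<le> l - 1 then {(w, l - 1)} else {}) - {a}"
  have ba: "{(w, l), a} \<in> L"
    using ab by (simp add: insert_commute)
  have H: "finite H" and U: "finite U" and D: "finite D"
    using nbhd_bounded by (auto simp: H_def U_def D_def)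
  have "upper_steps L m a b \<subseteq> H \<union> (U \<union> D)"
    by (auto simp: upper_steps_def layered_edges_iff nbhd_def H_def U_def D_def)
  then have "(\<Sum>c\<in>upper_steps L m a b. p * step_weight p m b c) \<le> (\<Sum>c\<in>H \<union> (U \<union> D). p * step_weight p m b c)"
    using H U D p_bounds step_weight_nonneg by (intro sum_mono2 mult_nonneg_nonneg) auto
  also have "\<dots> = (\<Sum>c\<in>H. p * step_weight p m b c) + ((\<Sum>c\<in>U. p * step_weight p m b c) + (\<Sum>c\<in>D. p * step_weight p m b c))"
    using H U D by (subst sum.union_disjoint, simp, simp, force simp: H_def U_def D_def,
      subst sum.union_disjoint) (auto simp: U_def D_def)
  also have "(\<Sum>c\<in>H. p * step_weight p m b c) = real (card H) * (p * X)"
  proof -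
    have "(\<Sum>c\<in>H. p * step_weight p m b c) = (\<Sum>c\<in>H. p * X)"
      by (intro sum.cong) (auto simp: H_def step_weight_def X_def)
    then show ?thesis
      by simp
  qed
  \<comment> \<open>Since \<open>m \<le> l\<close>, the vertex above \<open>b\<close> lies strictly
    above layer \<open>m\<close>, so the value \<open>1\<close> of an entering step does not occur
    here.\<close>
  also have "(\<Sum>c\<in>U. p * step_weight p m b c) = (if a = (w, l + 1) then 0 else p * (1 - p))"
    using b by (auto simp: U_def step_weight_def)
  also have "(\<Sum>c\<in>D. p * step_weight p m b c) = (if a = (w, l - 1) \<or> l \<le> m then 0 else p)"
    by (auto simp: D_def step_weight_def)
  finally have main: "S \<le> real (card H) * (p * X) +
      ((if a = (w, l + 1) then 0 else p * (1 - p)) + (if a = (w, l - 1) \<or> l \<le> m then 0 else p))"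
    by (simp add: S_def)
  have X0: "0 \<le> X"
    using p_bounds by (simp add: X_def)
  have card_le: "real (card H) \<le> \<Delta>"
  proof -
    have "card H \<le> card ((\<lambda>w. (w, l)) ` nbhd E w)"
      unfolding H_def using nbhd_bounded by (intro card_mono) auto
    also have "\<dots> \<le> card (nbhd E w)"
      using nbhd_bounded by (intro card_image_le) auto
    finally show ?thesis
      using nbhd_bounded(2)[of w] by linarith
  qed
  have HX: "real (card H) * (p * X) \<le> (1 - 1.4 * p) * X"
  proof -
    have "real (card H) * (p * X) \<le> \<Delta> * (p * X)"
      using card_le p_bounds X0 by (intro mult_right_mono) auto
    also have "\<dots> = p * \<Delta> * X"
      by simp
    also have "\<dots> \<le> (1 - 1.4 * p) * X"
      using p_bounds X0 by (intro mult_right_mono) auto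
    finally show ?thesis .
  qed
  have q1: "(1 - 1.4 * p) * X + p * (1 - p) \<le> 1 - p"
  proof -
    \<comment> \<open>Multiplied by 12, right side minus left side is
      \<open>5 * p^2 - 5 * p + 2\<close>, that is, 5/4 times this square plus 3/4.\<close>
    have "0 \<le> (2 * p - 1) ^ 2"
      by simp
    then show ?thesis
      by (simp add: X_def power2_eq_square field_simps)
  qed
  have q2: "0 \<le> p * (1 - p)"
    using p_bounds by simp
  consider "snd a = l" "fst a \<in> nbhd E w" | "a = (w, l + 1)" | "a = (w, l - 1)"
    using ba by (cases a) (auto simp: layered_edges_iff nbhd_def)
  then have "S + p * of_bool (l = m) \<le> step_weight p m a b"
  proof cases
    case 1
    have "step_weight p m a b = X"
      using 1 by (simp add: step_weight_def X_def)
    \<comment> \<open>The removed predecessor is itself a horizontal neighbour of \<open>b\<close>,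
      so at most \<open>\<Delta> - 1\<close> remain. This turns the factor
      \<open>1 - 1.4 * p\<close> into \<open>1 - 2.4 * p\<close>.\<close>
    have "a \<in> (\<lambda>w. (w, l)) ` nbhd E w"
      using 1 by (cases a) auto
    then have "Suc (card H) = card ((\<lambda>w. (w, l)) ` nbhd E w)"
      unfolding H_def using nbhd_bounded by (intro card_Suc_Diff1) auto
    also have "\<dots> \<le> card (nbhd E w)"
      using nbhd_bounded by (intro card_image_le) auto
    finally have "real (card H) \<le> \<Delta> - 1"
      using nbhd_bounded(2)[of w] by linarith
    then have "real (card H) * (p * X) \<le> (\<Delta> - 1) * (p * X)"
      using p_bounds X0 by (intro mult_right_mono) auto
    also have "\<dots> = (p * \<Delta> - p) * X"
      by (simp add: algebra_simps)
    also have "\<dots> \<le> (1 - 2.4 * p) * X"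
      using p_bounds X0 by (intro mult_right_mono) auto
    \<comment> \<open>The equation that defines \<open>X\<close>, rearranged: \<open>p\<close> pays
      for going down or ending, \<open>p * (1 - p)\<close> for going up.\<close>
    also have "\<dots> = X - p - p * (1 - p)"
      by (simp add: X_def field_simps)
    finally show ?thesis
      using main b p_bounds(1) q2 \<open>step_weight p m a b = X\<close> by (auto split: if_splits)
  next
    case 2
    \<comment> \<open>After a step down the walk cannot go up again; it goes on horizontally, or
      goes down or ends at cost \<open>p\<close>.\<close>
    have "(1 - 1.4 * p) * X + p \<le> 1"
      using q1 q2 by linarith
    then show ?thesis
      using main 2 HX b p_bounds(1) by (auto simp: step_weight_def split: if_splits)
  next
    case 3
    \<comment> \<open>After a step up there is no way down. For \<open>m < l\<close> the bound is
      \<open>q1\<close>; for \<open>l = m\<close> the ending term \<open>p\<close> is covered by the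
      weight \<open>1\<close> instead of \<open>1 - p\<close>.\<close>
    show ?thesis
      using main 3 HX q1 b p_bounds(1) by (auto simp: step_weight_def split: if_splits)
  qed
  then show ?thesis
    by (simp add: S_def)
qed

lemma finite_upper_walks: "finite (upper_walks L m k a b)"
  by (induction k arbitrary: a b) (auto simp: upper_walks_Suc finite_upper_steps)

text \<open>Induction on the length bound: the first-step recursion keeps the truncated generating
  function below a nonnegative superharmonic function.\<close>

lemma sum_upper_walks_le_step_weight:
  assumes "{a, b} \<in> L" and "m \<le> snd b"
  shows "p * (\<Sum>cs\<in>upper_walks L m k a b. p ^ length cs) \<le> step_weight p m a b"
  using assms
proof (induction k arbitrary: a b)
  case 0
  then show ?case
    by (simp add: step_weight_nonneg)
next
  case (Suc k)
  have "p * (\<Sum>cs\<in>upper_walks L m (Suc k) a b. p ^ length cs) =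
     (\<Sum>c\<in>upper_steps L m a b. p * (p * (\<Sum>cs\<in>upper_walks L m k b c. p ^ length cs))) + p * of_bool (snd b = m)"
    by (simp add: sum_upper_walks_Suc finite_upper_steps finite_upper_walks sum_distrib_left algebra_simps)
  also have "\<dots> \<le> (\<Sum>c\<in>upper_steps L m a b. p * step_weight p m b c) + p * of_bool (snd b = m)"
    using p_bounds
    by (intro add_right_mono sum_mono mult_left_mono Suc.IH) (auto simp: upper_steps_def)
  also have "\<dots> \<le> step_weight p m a b"
    by (rule step_weight_superharmonic[OF Suc.prems])
  finally show ?case .
qed

text \<open>The step entering layer \<open>m\<close> from below has weight \<open>1\<close>, which
  bounds every truncated sum; monotone convergence removes the truncation. The extra factor
  \<open>p\<close> is that of the entering vertical edge.\<close>

lemma nn_integral_upper_walks_le_1: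
  assumes "u \<in> V"
  shows "(\<integral>\<^sup>+ cs. ennreal (p ^ Suc (length cs))
    \<partial>count_space {cs. upper_walk L m (u, m - 1) (u, m) cs}) \<le> 1"
proof -
  let ?W = "{cs. upper_walk L m (u, m - 1) (u, m) cs}"
  let ?f = "\<lambda>k cs. ennreal (p ^ Suc (length cs)) * indicator {cs. length cs < k} cs"
  have bound: "(\<integral>\<^sup>+ cs. ?f k cs \<partial>count_space ?W) \<le> 1" for k
  proof -
    let ?F = "upper_walks L m k (u, m - 1) (u, m)"
    have "(\<integral>\<^sup>+ cs. ?f k cs \<partial>count_space ?W) = (\<Sum>cs\<in>?F. ?f k cs)"
      by (intro nn_integral_count_space' finite_upper_walks) (auto simp: upper_walks_def)
    also have "\<dots> = (\<Sum>cs\<in>?F. ennreal (p ^ Suc (length cs)))"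
      by (intro sum.cong) (auto simp: upper_walks_def)
    also have "\<dots> = ennreal (p * (\<Sum>cs\<in>?F. p ^ length cs))"
      using p_bounds by (simp add: sum_ennreal sum_distrib_left)
    also have "\<dots> \<le> ennreal (step_weight p m (u, m - 1) (u, m))"
      using assms by (intro ennreal_leI sum_upper_walks_le_step_weight) (auto simp: layered_edges_iff)
    also have "\<dots> = 1"
      by (simp add: step_weight_def)
    finally show ?thesis .
  qed
  have "(\<integral>\<^sup>+ cs. ennreal (p ^ Suc (length cs)) \<partial>count_space ?W) =
      (\<integral>\<^sup>+ cs. (SUP k. ?f k cs) \<partial>count_space ?W)"
  proof (intro nn_integral_cong)
    fix cs :: "('a \<times> int) list"
    show "ennreal (p ^ Suc (length cs)) = (SUP k. ?f k cs)"
    proof (rule antisym)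
      show "ennreal (p ^ Suc (length cs)) \<le> (SUP k. ?f k cs)"
        by (rule SUP_upper2[of "Suc (length cs)"]) auto
    qed (auto intro!: SUP_least split: split_indicator)
  qed
  also have "\<dots> = (SUP k. \<integral>\<^sup>+ cs. ?f k cs \<partial>count_space ?W)"
    by (intro nn_integral_monotone_convergence_SUP)
       (auto simp: incseq_def le_fun_def split: split_indicator)
  also have "\<dots> \<le> 1"
    using bound by (intro SUP_least) auto
  finally show ?thesis .
qed

end

section \<open>Measurability and independence of connection events\<close>

text \<open>A countable vertex set has only countably many finite paths, and each path is open on a
  finite intersection of coordinate events.\<close>

lemma sets_PiM_joined:
  fixes F :: "'b set set" and q :: "'b set \<Rightarrow> bool pmf"
  assumes "countable U"
  shows "{\<omega> \<in> space (PiM F (\<lambda>e. measure_pmf (q e))). joined U {e \<in> F. \<omega> e} a c}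
    \<in> sets (PiM F (\<lambda>e. measure_pmf (q e)))"
proof -
  let ?M = "PiM F (\<lambda>e. measure_pmf (q e))"
  define X where "X = {xs \<in> lists U. graph_path U F xs \<and> hd xs = a \<and> last xs = c}"
  have "countable X"
    by (rule countable_subset[OF _ countable_lists[OF assms]]) (auto simp: X_def)
  moreover have "{\<omega> \<in> space ?M. \<forall>e\<in>path_edges xs. \<omega> e} \<in> sets ?M" if "xs \<in> X" for xs
  proof -
    have "{\<omega> \<in> space ?M. \<omega> e} \<in> sets ?M" if "e \<in> path_edges xs" for e
      using that \<open>xs \<in> X\<close> by (intro sets_Collect_single'[where P = "\<lambda>x. x"]) (auto simp: X_def graph_path_iff)
    then show ?thesis
      by (intro sets.sets_Collect_finite_All) auto
  qed
  ultimately have "(\<Union>xs\<in>X. {\<omega> \<in> space ?M. \<forall>e\<in>path_edges xs. \<omega> e}) \<in> sets ?M"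
    by (intro sets.countable_UN') auto
  also have "(\<Union>xs\<in>X. {\<omega> \<in> space ?M. \<forall>e\<in>path_edges xs. \<omega> e}) =
      {\<omega> \<in> space ?M. joined U {e \<in> F. \<omega> e} a c}"
    by (auto simp: X_def joined_def graph_path_iff)
  finally show ?thesis .
qed

context layered_percolation
begin

text \<open>Deleting \<open>K\<close> makes the event depend only on edges outside \<open>K\<close>,
  hence independent of the states in \<open>K\<close>. For \<open>K = {}\<close> it is the plain
  connection event.\<close>

definition joined_off :: "('a \<times> int) set set \<Rightarrow> 'a \<times> int \<Rightarrow> 'a \<times> int \<Rightarrow> (('a \<times> int) set \<Rightarrow> bool) set" where
  "joined_off K a c = {\<omega> \<in> space (percolation V E p). joined (layered_verts V) (open_edges V E \<omega> - K) a c}"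

text \<open>By connectedness every vertex is reachable from \<open>r\<close>, and finite
  neighbourhoods keep the reachable set countable.\<close>

lemma countable_verts: "countable V"
proof (rule countable_subset)
  let ?R = "{(x, y). {x, y} \<in> E}"
  show "countable (?R\<^sup>* `` {r})"
  proof (rule countable_rtrancl)
    fix Y :: "'a set"
    assume "countable Y"
    have "?R `` Y = (\<Union>x\<in>Y. nbhd E x)"
      by (auto simp: nbhd_def)
    then show "countable (?R `` Y)"
      using \<open>countable Y\<close> nbhd_bounded(1) by (metis countable_UN countable_finite)
  qed auto
  show "V \<subseteq> ?R\<^sup>* `` {r}"
  proof
    fix v
    assume "v \<in> V"
    then obtain xs where xs: "graph_path V E xs" "hd xs = r" "last xs = v"
      using conn root unfolding connected_graph_def joined_def by blast
    have "(hd xs, last xs) \<in> ?R\<^sup>*" if "xs \<noteq> []" "successively (\<lambda>x y. {x, y} \<in> E) xs" for xs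
      using that
    proof (induction xs rule: induct_list012)
      case (3 x y zs)
      then show ?case
        by (auto intro: converse_rtrancl_into_rtrancl)
    qed auto
    then show "v \<in> ?R\<^sup>* `` {r}"
      using xs by (auto simp: graph_path_def)
  qed
qed

lemma countable_layered_verts: "countable (layered_verts V)"
  using countable_verts by (simp add: layered_verts_def)

lemma joined_off_eq:
  fixes K :: "('a \<times> int) set set"
  defines "M \<equiv> PiM (L - K) (\<lambda>_. measure_pmf (bernoulli_pmf p))"
  defines "B \<equiv> \<lambda>a c. {\<omega> \<in> space M. joined (layered_verts V) {e \<in> L - K. \<omega> e} a c}"
  shows "B a c \<in> sets M"
    and "joined_off K a c = {\<omega> \<in> space (percolation V E p). restrict \<omega> (L - K) \<in> B a c}"
proof -
  show "B a c \<in> sets M"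
    unfolding B_def M_def by (rule sets_PiM_joined[OF countable_layered_verts])
  have "{e \<in> L - K. restrict \<omega> (L - K) e} = open_edges V E \<omega> - K" for \<omega>
    by (auto simp: open_edges_def)
  then show "joined_off K a c = {\<omega> \<in> space (percolation V E p). restrict \<omega> (L - K) \<in> B a c}"
    by (auto simp: joined_off_def B_def M_def space_PiM percolation_def)
qed

lemma sets_joined_off: "joined_off K a c \<in> sets (percolation V E p)"
proof -
  have "(\<lambda>\<omega>. restrict \<omega> (L - K)) \<in> measurable (percolation V E p)
      (PiM (L - K) (\<lambda>_. measure_pmf (bernoulli_pmf p)))"
    unfolding percolation_def by (rule measurable_restrict_subset) auto
  from measurable_sets[OF this joined_off_eq(1)] show ?thesis
    unfolding joined_off_eq(2) vimage_def Int_def by (simp add: conj_commute)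
qed

lemma sets_open:
  assumes "finite K" "K \<subseteq> L"
  shows "{\<omega> \<in> space (percolation V E p). \<forall>e\<in>K. \<omega> e} \<in> sets (percolation V E p)"
proof -
  have "{\<omega> \<in> space (percolation V E p). \<omega> e} \<in> sets (percolation V E p)" if "e \<in> K" for e
    unfolding percolation_def using that assms
    by (intro sets_Collect_single'[where P = "\<lambda>x. x"]) auto
  then show ?thesis
    using assms by (intro sets.sets_Collect_finite_All) auto
qed

text \<open>Independence gives equality with \<open>joined_off K a c\<close> on the right; allowing
  the edges of \<open>K\<close> again only enlarges that event.\<close>

lemma emeasure_open_joined_off_le:
  assumes "finite K" "K \<subseteq> L"
  shows "emeasure (percolation V E p) ({\<omega> \<in> space (percolation V E p). \<forall>e\<in>K. \<omega> e} \<inter> joined_off K a c)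
    \<le> ennreal (p ^ card K) * emeasure (percolation V E p) (joined_off {} a c)"
proof -
  let ?P = "percolation V E p"
  have "{(r, 0), (r, 1)} \<in> L"
    using root by (simp add: layered_edges_iff)
  then have "L \<noteq> {}"
    by blast
  define B where "B = {\<omega> \<in> space (PiM (L - K) (\<lambda>_. measure_pmf (bernoulli_pmf p))).
      joined (layered_verts V) {e \<in> L - K. \<omega> e} a c}"
  have B: "B \<in> sets (PiM (L - K) (\<lambda>_. measure_pmf (bernoulli_pmf p)))"
    and eq: "joined_off K a c = {\<omega> \<in> space ?P. restrict \<omega> (L - K) \<in> B}"
    using joined_off_eq[of K] unfolding B_def by blast+
  have "{\<omega> \<in> space ?P. \<forall>e\<in>K. \<omega> e} \<inter> joined_off K a c =
      {\<omega> \<in> space ?P. (\<forall>e\<in>K. \<omega> e) \<and> restrict \<omega> (L - K) \<in> B}"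
    unfolding eq by blast
  then have "emeasure ?P ({\<omega> \<in> space ?P. \<forall>e\<in>K. \<omega> e} \<inter> joined_off K a c) =
      ennreal (p ^ card K) * emeasure ?P (joined_off K a c)"
    using PiM_bernoulli_open_indep[OF p_bounds(1,3) assms \<open>L \<noteq> {}\<close> B]
    unfolding percolation_def[symmetric] eq by simp
  also have "\<dots> \<le> ennreal (p ^ card K) * emeasure ?P (joined_off {} a c)"
  proof (intro mult_left_mono emeasure_mono sets_joined_off)
    show "joined_off K a c \<subseteq> joined_off {} a c"
      unfolding joined_off_def by (auto intro: joined_mono)
  qed simp
  finally show ?thesis .
qed

section \<open>Comparing the expected counts of consecutive layers\<close>

lemma expected_layer_count_eq:
  "expected_layer_count V E r p n =
     (\<integral>\<^sup>+ u. emeasure (percolation V E p) (joined_off {} (u, int n) (r, 0)) \<partial>count_space V)"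
proof -
  let ?P = "percolation V E p"
  have "layer_count V E r n \<omega> = (\<integral>\<^sup>+ u. indicator (joined_off {} (u, int n) (r, 0)) \<omega> \<partial>count_space V)"
    if "\<omega> \<in> space ?P" for \<omega>
  proof -
    let ?A = "{v \<in> V. open_joined V E \<omega> (v, int n) (r, 0)}"
    have "(\<integral>\<^sup>+ u. indicator (joined_off {} (u, int n) (r, 0)) \<omega> \<partial>count_space V) =
        (\<integral>\<^sup>+ u. indicator (joined_off {} (u, int n) (r, 0)) \<omega> * indicator V u \<partial>count_space UNIV)"
      by (subst nn_integral_count_space_indicator) simp_all
    also have "\<dots> = (\<integral>\<^sup>+ u. indicator ?A u \<partial>count_space UNIV)"
      using that by (intro nn_integral_cong)
        (auto simp: joined_off_def open_joined_def split: split_indicator)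
    finally show ?thesis
      by (simp add: layer_count_def)
  qed
  then have "expected_layer_count V E r p n =
      (\<integral>\<^sup>+ \<omega>. \<integral>\<^sup>+ u. indicator (joined_off {} (u, int n) (r, 0)) \<omega> \<partial>count_space V \<partial>?P)"
    unfolding expected_layer_count_def by (intro nn_integral_cong) auto
  also have "\<dots> = (\<integral>\<^sup>+ u. \<integral>\<^sup>+ \<omega>. indicator (joined_off {} (u, int n) (r, 0)) \<omega> \<partial>?P \<partial>count_space V)"
    using sets_joined_off by (intro nn_integral_count_space_nn_integral countable_verts) auto
  also have "\<dots> = (\<integral>\<^sup>+ u. emeasure ?P (joined_off {} (u, int n) (r, 0)) \<partial>count_space V)"
    using sets_joined_off by (intro nn_integral_cong nn_integral_indicator)
  finally show ?thesis .
qed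

text \<open>The path is cut at its first vertex \<open>z\<close> below layer \<open>m\<close>. The
  piece before \<open>z\<close>, read backwards from \<open>z\<close>, is the upper walk; the piece
  after \<open>z\<close> shares no edge with it because the path is self-avoiding.\<close>

lemma joined_layer_cases:
  assumes "open_joined V E \<omega> (v, m) (r, 0)" and "0 < m"
  obtains u cs where "u \<in> V" "upper_walk L m (u, m - 1) (u, m) cs"
    "distinct ((u, m - 1) # (u, m) # cs)" "last ((u, m) # cs) = (v, m)"
    "\<forall>e\<in>path_edges ((u, m - 1) # (u, m) # cs). \<omega> e"
    "joined (layered_verts V) (open_edges V E \<omega> - path_edges ((u, m - 1) # (u, m) # cs)) (u, m - 1) (r, 0)"
proof -
  let ?O = "open_edges V E \<omega>"
  obtain xs where xs: "graph_path (layered_verts V) ?O xs" "hd xs = (v, m)" "last xs = (r, 0)"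
    using assms(1) unfolding open_joined_def joined_def by blast
  then have "\<exists>x\<in>set xs. snd x < m"
    using assms(2) by (metis graph_path_def last_in_set snd_conv)
  then obtain ys z zs where split: "xs = ys @ z # zs" "snd z < m" "\<forall>y\<in>set ys. \<not> snd y < m"
    by (rule split_list_first_propE)
  have "ys \<noteq> []"
    using split xs(2) by auto
  then obtain b cs where b: "rev ys = b # cs"
    by (cases "rev ys") auto
  have suc: "successively (\<lambda>x y. {x, y} \<in> ?O) (ys @ z # zs)"
    and dist: "distinct (ys @ z # zs)" and verts: "set (ys @ z # zs) \<subseteq> layered_verts V"
    using xs(1) split(1) by (auto simp: graph_path_def)
  then have "successively (\<lambda>x y. {x, y} \<in> ?O) ((ys @ [z]) @ zs)"
    by simp
  then have "successively (\<lambda>x y. {x, y} \<in> ?O) (rev (ys @ [z]))"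
    unfolding successively_rev successively_append_iff by (simp add: insert_commute)
  then have up: "path_edges (z # b # cs) \<subseteq> ?O"
    unfolding path_edges_subset_iff using b by simp
  have down: "path_edges (z # zs) \<subseteq> ?O"
    unfolding path_edges_subset_iff using suc by (simp add: successively_append_iff)
  have OL: "?O \<subseteq> L"
    by (auto simp: open_edges_def)
  have set_ys: "set ys = insert b (set cs)"
    using b by (metis list.simps(15) set_rev)
  define u where "u = fst z"
  \<comment> \<open>An edge from a layer \<open>\<ge> m\<close> to a layer \<open>< m\<close> must
    be vertical and join layers \<open>m\<close> and \<open>m - 1\<close>.\<close>
  have "{b, z} \<in> L"
    using up OL by (auto simp: insert_commute)
  moreover have "m \<le> snd b"
    using split(3) set_ys by auto
  ultimately have bz: "b = (u, m)" "z = (u, m - 1)"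
    using split(2) by (cases b; cases z; auto simp: layered_edges_iff u_def)+
  have last: "last (b # cs) = (v, m)"
    using \<open>ys \<noteq> []\<close> xs(2) split(1) b by (metis hd_append2 last_rev)
  have dist': "distinct (z # b # cs)"
    using dist b set_ys by (metis (no_types, lifting) b disjoint_iff distinct.simps(2) distinct_append
        distinct_rev list.set_intros(1) set_rev)
  have walk: "upper_walk L m z b cs"
  proof (rule upper_walkI)
    show "path_edges (z # b # cs) \<subseteq> L"
      using up OL by blast
    show "\<forall>c\<in>set cs. m \<le> snd c"
      using split(3) set_ys by auto
  qed (use dist' last in auto)
  have "u \<in> V"
    using verts bz by (auto simp: layered_verts_def)
  moreover have "joined (layered_verts V) (?O - path_edges (z # b # cs)) z (r, 0)"
    unfolding joined_def graph_path_iff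
  proof (intro exI[of _ "z # zs"] conjI)
    show "path_edges (z # zs) \<subseteq> ?O - path_edges (z # b # cs)"
      using down path_edges_append_disjoint[OF dist] b by auto
  qed (use verts dist xs(3) split(1) in auto)
  moreover have "\<forall>e\<in>path_edges (z # b # cs). \<omega> e"
    using up by (auto simp: open_edges_def)
  ultimately show ?thesis
    using that walk dist' last unfolding bz by blast
qed

lemma expected_layer_count_Suc_le:
  "expected_layer_count V E r p (n + 1) \<le> expected_layer_count V E r p n"
proof -
  let ?P = "percolation V E p"
  define m where "m = int n + 1"
  define W where "W u = {cs. upper_walk L m (u, m - 1) (u, m) cs}" for u
  define K where "K = (\<lambda>(u :: 'a, cs). path_edges ((u, m - 1) # (u, m) # cs))"
  define A where "A = (\<lambda>(u, cs). {\<omega> \<in> space ?P. \<forall>e\<in>K (u, cs). \<omega> e} \<inter> joined_off (K (u, cs)) (u, m - 1) (r, 0))"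
  define J where "J u = emeasure ?P (joined_off {} (u, m - 1) (r, 0))" for u
  \<comment> \<open>Distinctness is kept here so that a piece with \<open>cs\<close> has exactly
    \<open>Suc (length cs)\<close> different edges, which gives the power of
    \<open>p\<close>.\<close>
  define \<Gamma> where "\<Gamma> = {(u, cs). u \<in> V \<and> cs \<in> W u \<and> distinct ((u, m - 1) # (u, m) # cs)}"
  have K_L: "K x \<subseteq> L" if "x \<in> \<Gamma>" for x
    using that path_edges_upper_walk by (fastforce simp: \<Gamma>_def W_def K_def layered_edges_iff)
  have finK: "finite (K x)" for x
    by (simp add: K_def split: prod.split)
  have A_sets: "A x \<in> sets ?P" if "x \<in> \<Gamma>" for x
    using sets_open[OF finK K_L[OF that]] sets_joined_off by (auto simp: A_def split: prod.split)
  have A_le: "emeasure ?P (A x) \<le> ennreal (p ^ Suc (length (snd x))) * J (fst x)" if "x \<in> \<Gamma>" for x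
  proof -
    have "card (K x) = Suc (length (snd x))"
    proof (cases x)
      case (Pair u cs)
      then show ?thesis
        using that card_path_edges[of "(u, m - 1) # (u, m) # cs"] by (simp add: \<Gamma>_def K_def del: path_edges.simps)
    qed
    then show ?thesis
      using emeasure_open_joined_off_le[OF finK K_L[OF that]]
      by (auto simp: A_def J_def split: prod.split)
  qed
  have "\<Gamma> \<subseteq> V \<times> lists (layered_verts V)"
    by (auto simp: \<Gamma>_def W_def dest: upper_walk_verts)
  then have "countable \<Gamma>"
    using countable_verts countable_layered_verts by (auto intro: countable_subset)
  have "layer_count V E r (n + 1) \<omega> \<le> (\<integral>\<^sup>+ x. indicator (A x) \<omega> \<partial>count_space \<Gamma>)"
    if \<omega>: "\<omega> \<in> space ?P" for \<omega>
  proof -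
    \<comment> \<open>Union bound: \<open>v\<close> is recovered from the pair
      \<open>(u, cs)\<close> as the end of the walk, so the vertices reached are at most as many as
      the pairs in \<open>\<Gamma>\<close> whose event occurs.\<close>
    have "{v \<in> V. open_joined V E \<omega> (v, m) (r, 0)} \<subseteq>
        (\<lambda>(u, cs). fst (last ((u, m) # cs))) ` {x \<in> \<Gamma>. \<omega> \<in> A x}"
    proof
      fix v
      assume "v \<in> {v \<in> V. open_joined V E \<omega> (v, m) (r, 0)}"
      then obtain u cs where "u \<in> V" "upper_walk L m (u, m - 1) (u, m) cs"
        "distinct ((u, m - 1) # (u, m) # cs)" "last ((u, m) # cs) = (v, m)"
        "\<forall>e\<in>path_edges ((u, m - 1) # (u, m) # cs). \<omega> e"
        "joined (layered_verts V) (open_edges V E \<omega> - path_edges ((u, m - 1) # (u, m) # cs)) (u, m - 1) (r, 0)"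
        using joined_layer_cases[of \<omega> v m] by (auto simp: m_def)
      then show "v \<in> (\<lambda>(u, cs). fst (last ((u, m) # cs))) ` {x \<in> \<Gamma>. \<omega> \<in> A x}"
        using \<omega> by (intro image_eqI[of _ _ "(u, cs)"])
          (simp_all add: \<Gamma>_def W_def A_def K_def joined_off_def)
    qed
    then have "layer_count V E r (n + 1) \<omega> \<le>
        emeasure (count_space UNIV) ((\<lambda>(u, cs). fst (last ((u, m) # cs))) ` {x \<in> \<Gamma>. \<omega> \<in> A x})"
      unfolding layer_count_def m_def by (intro emeasure_mono) (auto simp: add.commute)
    also have "\<dots> \<le> emeasure (count_space UNIV) {x \<in> \<Gamma>. \<omega> \<in> A x}"
      by (rule emeasure_count_space_image_le)
    also have "\<dots> = (\<integral>\<^sup>+ x. indicator {x \<in> \<Gamma>. \<omega> \<in> A x} x \<partial>count_space UNIV)"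
      by simp
    also have "\<dots> = (\<integral>\<^sup>+ x. indicator (A x) \<omega> * indicator \<Gamma> x \<partial>count_space UNIV)"
      by (intro nn_integral_cong) (auto split: split_indicator)
    also have "\<dots> = (\<integral>\<^sup>+ x. indicator (A x) \<omega> \<partial>count_space \<Gamma>)"
      by (subst nn_integral_count_space_indicator[of \<Gamma>]) simp_all
    finally show ?thesis .
  qed
  then have "expected_layer_count V E r p (n + 1) \<le> (\<integral>\<^sup>+ \<omega>. \<integral>\<^sup>+ x. indicator (A x) \<omega> \<partial>count_space \<Gamma> \<partial>?P)"
    unfolding expected_layer_count_def by (intro nn_integral_mono) auto
  also have "\<dots> = (\<integral>\<^sup>+ x. \<integral>\<^sup>+ \<omega>. indicator (A x) \<omega> \<partial>?P \<partial>count_space \<Gamma>)"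
    using A_sets by (intro nn_integral_count_space_nn_integral \<open>countable \<Gamma>\<close>) auto
  also have "\<dots> = (\<integral>\<^sup>+ x. emeasure ?P (A x) \<partial>count_space \<Gamma>)"
    using A_sets by (intro nn_integral_cong nn_integral_indicator) auto
  also have "\<dots> \<le> (\<integral>\<^sup>+ x. ennreal (p ^ Suc (length (snd x))) * J (fst x) \<partial>count_space \<Gamma>)"
    using A_le by (intro nn_integral_mono) auto
  also have "\<dots> = (\<integral>\<^sup>+ x. ennreal (p ^ Suc (length (snd x))) * J (fst x) * indicator \<Gamma> x \<partial>count_space UNIV)"
    by (subst nn_integral_count_space_indicator[of \<Gamma>]) simp_all
  also have "\<dots> = (\<integral>\<^sup>+ u. \<integral>\<^sup>+ cs. ennreal (p ^ Suc (length cs)) * J u * indicator \<Gamma> (u, cs)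
      \<partial>count_space UNIV \<partial>count_space UNIV)"
    by (subst nn_integral_fst_count_space[symmetric]) simp
  also have "\<dots> \<le> (\<integral>\<^sup>+ u. J u * indicator V u \<partial>count_space UNIV)"
  proof (intro nn_integral_mono)
    fix u
    \<comment> \<open>Distinctness is now dropped, enlarging the sum to all upper walks, for which
      the generating function bound holds.\<close>
    have "(\<integral>\<^sup>+ cs. ennreal (p ^ Suc (length cs)) * J u * indicator \<Gamma> (u, cs) \<partial>count_space UNIV) \<le>
        (\<integral>\<^sup>+ cs. (J u * indicator V u) * (ennreal (p ^ Suc (length cs)) * indicator (W u) cs) \<partial>count_space UNIV)"
      by (intro nn_integral_mono) (auto simp: \<Gamma>_def mult.commute split: split_indicator)
    also have "\<dots> = (J u * indicator V u) * (\<integral>\<^sup>+ cs. ennreal (p ^ Suc (length cs)) \<partial>count_space (W u))"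
      by (subst nn_integral_cmult, simp, subst nn_integral_count_space_indicator[of "W u"]) simp_all
    also have "\<dots> \<le> (J u * indicator V u) * 1"
    proof (cases "u \<in> V")
      case True
      then show ?thesis
        unfolding W_def by (intro mult_left_mono nn_integral_upper_walks_le_1) simp_all
    qed simp
    finally show "(\<integral>\<^sup>+ cs. ennreal (p ^ Suc (length cs)) * J u * indicator \<Gamma> (u, cs) \<partial>count_space UNIV) \<le>
        J u * indicator V u"
      by simp
  qed
  also have "\<dots> = (\<integral>\<^sup>+ u. J u \<partial>count_space V)"
    by (subst nn_integral_count_space_indicator[of V]) simp_all
  also have "\<dots> = expected_layer_count V E r p n"
    by (simp add: expected_layer_count_eq J_def m_def)
  finally show ?thesis .
qed

end

theorem theorem2:
  fixes V :: "'a set" and E :: "'a set set" and \<Delta> :: real and r :: 'a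
  assumes "simple_graph V E"
    and "connected_graph V E"
    and "degrees_bounded_by V E \<Delta>"
    and "r \<in> V"
  shows "\<forall>n::nat. \<forall>p\<in>{0..1 / (\<Delta> + 1.4)}.
           expected_layer_count V E r p n \<ge> expected_layer_count V E r p (n + 1)"
  using assms by (intro allI ballI layered_percolation.expected_layer_count_Suc_le)
    (unfold_locales)

end
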